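(* Consider the averaged conservative Keplerian spin-spin model (coupling parameter $\chi=1$) in the $(1:1,3:2)$ resonance, linearized at the critical point $(\varphi_1,\varphi_2,J_1,J_2)=(0,0,0,0)$, that is, the linear system in $(\xi_1,\xi_2,J_1,J_2)$ $$\dot\xi_1=\frac{2}{C_1}J_1,\qquad \dot\xi_2=\frac{2}{C_2}J_2,$$ $$\dot J_1=-(K_1+K_2+2K_3+K_4+K_5)\,\xi_1-(K_4-K_5)\,\xi_2,$$ $$\dot J_2=-(L_4-L_5)\,\xi_1-(L_1+L_2+2L_3+L_4+L_5)\,\xi_2,$$ where the constants are $$K_1=\frac{3d_1GM_2}{2a^3}\Bigl(1-\frac52e^2\Bigr),\quad L_1=\frac{21d_2eGM_1}{4a^3},$$ $$K_2=\Bigl(\frac{75d_1GM_2q_1}{56a^5M_1}+\frac{15d_1Gq_2}{8a^5}\Bigr)(1+e^2),\quad L_2=\frac{135d_2eGq_1}{16a^5}+\frac{675d_2eGM_1q_2}{112a^5M_2},$$ $$K_3=\frac{75d_1^2GM_2}{16a^5M_1}(1-11e^2),\quad L_3=\frac{3825d_2^2e^2GM_1}{32a^5M_2},$$ $$K_4=L_4=\frac{1365d_1d_2eG}{32a^5},\quad K_5=L_5=\frac{45d_1d_2eG}{32a^5}.$$ For $e<\frac{1}{\sqrt{11}}$, the eigenvalues of this linear system are purely imaginary.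
   Context: Two homogeneous rigid ellipsoids $\mathcal E_1,\mathcal E_2$ with masses $M_1,M_2$ and principal moments of inertia $A_j\le B_j\le C_j$ ($j=1,2$) move on a Keplerian orbit with semimajor axis $a$ and eccentricity $e$; the spin axis of each body is perpendicular to the orbital plane and has the direction of its shortest physical axis. Units are normalized so that $M_1+M_2=1$, $C_1+C_2=1$ and the orbital period is $2\pi$, so that the gravitational constant is $G=a^3$. Put $d_j=B_j-A_j$ and $q_j=2C_j-B_j-A_j$; one has $0\le d_j\le C_j\le 1$ and $d_j\le q_j\le 2C_j\le 2$. If $\theta_j$ are the rotation angles and $t$ is time, the resonant angles for the $(1:1,3:2)$ resonance are $\varphi_1=2\theta_1-2t$, $\varphi_2=2\theta_2-3t$. Expanding the potential to second order in $e$ and keeping only the terms that do not vanish after averaging over time, the conservative equations for $\chi=1$ are $\dot\varphi_1=\frac{2}{C_1}J_1$, $\dot\varphi_2=\frac{2}{C_2}J_2$, $\dot J_1=-(K_1+K_2)\sin\varphi_1-K_3\sin2\varphi_1-K_4\sin(\varphi_1+\varphi_2)-K_5\sin(\varphi_1-\varphi_2)$, $\dot J_2=-(L_1+L_2)\sin\varphi_2-L_3\sin2\varphi_2-L_4\sin(\varphi_1+\varphi_2)+L_5\sin(\varphi_1-\varphi_2)$; $\xi_j$ denotes the small displacement of $\varphi_j$ from the critical point. *)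

theory Defs
  imports "HOL-Analysis.Product_Vector" "Jordan_Normal_Form.Char_Poly"
begin

text \<open>A homogeneous ellipsoid of mass \<open>M\<close> with semi-axes \<open>u \<ge> v \<ge> w > 0\<close> has the principal
  moments of inertia below; \<open>C\<close> is the moment about the shortest physical axis.\<close>

definition homogeneous_ellipsoid :: "real \<Rightarrow> real \<Rightarrow> real \<Rightarrow> real \<Rightarrow> bool" where
  "homogeneous_ellipsoid M A B C \<longleftrightarrow> 0 < M \<and>
     (\<exists>u v w. 0 < w \<and> w \<le> v \<and> v \<le> u \<and>
        A = M * (v\<^sup>2 + w\<^sup>2) / 5 \<and> B = M * (u\<^sup>2 + w\<^sup>2) / 5 \<and> C = M * (u\<^sup>2 + v\<^sup>2) / 5)"

lemma homogeneous_ellipsoidD: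
  assumes "homogeneous_ellipsoid M A B C"
  shows "0 < M" "0 < A" "A \<le> B" "B \<le> C" "C < A + B"
proof -
  from assms obtain u v w where M: "0 < M" and uvw: "0 < w" "w \<le> v" "v \<le> u"
    and A: "A = M * (v\<^sup>2 + w\<^sup>2) / 5" and B: "B = M * (u\<^sup>2 + w\<^sup>2) / 5"
    and C: "C = M * (u\<^sup>2 + v\<^sup>2) / 5"
    unfolding homogeneous_ellipsoid_def by blast
  have sq: "0 < w\<^sup>2" "w\<^sup>2 \<le> v\<^sup>2" "v\<^sup>2 \<le> u\<^sup>2"
    using uvw by (auto intro: power_mono)
  show "0 < M" by (rule M)
  show "0 < A" using M sq unfolding A by (intro divide_pos_pos mult_pos_pos add_nonneg_pos) auto
  show "A \<le> B" using M sq unfolding A B by simp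
  show "B \<le> C" using M sq unfolding B C by simp
  have "A + B - C = M * (2 * w\<^sup>2) / 5" unfolding A B C by (simp add: field_simps)
  moreover have "0 < M * (2 * w\<^sup>2) / 5" using M sq by simp
  ultimately show "C < A + B" by linarith
qed

text \<open>The averaged conservative equations for the \<open>(1:1, 3:2)\<close> resonance with coupling parameter
  \<open>\<chi> = 1\<close>, in the coordinates \<open>(\<phi>\<^sub>1, \<phi>\<^sub>2, J\<^sub>1, J\<^sub>2)\<close>.\<close>

definition spin_spin_field ::
  "real \<Rightarrow> real \<Rightarrow> real \<Rightarrow> real \<Rightarrow> real \<Rightarrow> real \<Rightarrow> real \<Rightarrow> real \<Rightarrow> real \<Rightarrow> real \<Rightarrow> real \<Rightarrow> real
    \<Rightarrow> real \<times> real \<times> real \<times> real \<Rightarrow> real \<times> real \<times> real \<times> real" where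
  "spin_spin_field C1 C2 K1 K2 K3 K4 K5 L1 L2 L3 L4 L5 = (\<lambda>(p1, p2, J1, J2).
     (2 / C1 * J1,
      2 / C2 * J2,
      - (K1 + K2) * sin p1 - K3 * sin (2 * p1) - K4 * sin (p1 + p2) - K5 * sin (p1 - p2),
      - (L1 + L2) * sin p2 - L3 * sin (2 * p2) - L4 * sin (p1 + p2) + L5 * sin (p1 - p2)))"

text \<open>The coefficient matrix, in the coordinates \<open>(\<xi>\<^sub>1, \<xi>\<^sub>2, J\<^sub>1, J\<^sub>2)\<close>, of the linearization of
  \<open>spin_spin_field\<close> at its critical point; that it is the Jacobian there is proved below.\<close>

definition spin_spin_linear ::
  "real \<Rightarrow> real \<Rightarrow> real \<Rightarrow> real \<Rightarrow> real \<Rightarrow> real \<Rightarrow> real \<Rightarrow> real \<Rightarrow> real \<Rightarrow> real \<Rightarrow> real \<Rightarrow> real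
    \<Rightarrow> real mat" where
  "spin_spin_linear C1 C2 K1 K2 K3 K4 K5 L1 L2 L3 L4 L5 = mat_of_rows_list 4
     [[0, 0, 2 / C1, 0],
      [0, 0, 0, 2 / C2],
      [- (K1 + K2 + 2 * K3 + K4 + K5), - (K4 - K5), 0, 0],
      [- (L4 - L5), - (L1 + L2 + 2 * L3 + L4 + L5), 0, 0]]"

lemma spin_spin_field_critical:
  "spin_spin_field C1 C2 K1 K2 K3 K4 K5 L1 L2 L3 L4 L5 (0, 0, 0, 0) = (0, 0, 0, 0)"
  by (simp add: spin_spin_field_def)

lemma spin_spin_linear_mult_vec:
  "spin_spin_linear C1 C2 K1 K2 K3 K4 K5 L1 L2 L3 L4 L5 *\<^sub>v vec_of_list [x1, x2, J1, J2] =
   vec_of_list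
     [2 / C1 * J1,
      2 / C2 * J2,
      - (K1 + K2 + 2 * K3 + K4 + K5) * x1 - (K4 - K5) * x2,
      - (L4 - L5) * x1 - (L1 + L2 + 2 * L3 + L4 + L5) * x2]"
  by (rule eq_vecI)
    (auto simp: spin_spin_linear_def mat_of_rows_list_def scalar_prod_def
      numeral_eq_Suc less_Suc_eq vec_of_list_index algebra_simps)

lemma spin_spin_field_has_derivative:
  "(spin_spin_field C1 C2 K1 K2 K3 K4 K5 L1 L2 L3 L4 L5 has_derivative
     (\<lambda>(x1, x2, J1, J2).
       (2 / C1 * J1,
        2 / C2 * J2,
        - (K1 + K2 + 2 * K3 + K4 + K5) * x1 - (K4 - K5) * x2,
        - (L4 - L5) * x1 - (L1 + L2 + 2 * L3 + L4 + L5) * x2))) (at (0, 0, 0, 0))"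
  unfolding spin_spin_field_def case_prod_beta
  by (rule derivative_eq_intros has_derivative_Pair refl | simp)+
    (auto simp: fun_eq_iff algebra_simps)

end

theory Submission
  imports Defs
begin

text \<open>With stiffness matrix \<open>S\<close>, an eigenvector with positional part \<open>(x, y)\<close> satisfies
  \<open>\<mu>\<^sup>2 (C\<^sub>1 |x|\<^sup>2 + C\<^sub>2 |y|\<^sup>2) / 2 = - (x, y)\<^sup>* S (x, y)\<close>. Since \<open>K\<^sub>4 = L\<^sub>4\<close> and \<open>K\<^sub>5 = L\<^sub>5\<close> the matrix
  \<open>S\<close> is symmetric, and it is diagonally dominant because \<open>K\<^sub>4 + K\<^sub>5 \<ge> |K\<^sub>4 - K\<^sub>5|\<close> and the other
  constants are nonnegative for \<open>e\<^sup>2 < 1/11\<close>. Hence \<open>\<mu>\<^sup>2\<close> is a nonpositive real number.\<close>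

text \<open>The imaginary part of the square forces \<open>Re \<mu> * Im \<mu> = 0\<close>. If
  \<open>Im \<mu> = 0\<close>, then \<open>(Re \<mu>)\<^sup>2 = t \<le> 0\<close>, so
  \<open>\<mu> = 0\<close>; zero counts as purely imaginary here.\<close>

lemma Re_eq_0_if_power2_nonpos:
  fixes \<mu> :: complex
  assumes "\<mu>\<^sup>2 = of_real t" and "t \<le> 0"
  shows "Re \<mu> = 0"
proof -
  have "(Re \<mu>)\<^sup>2 - (Im \<mu>)\<^sup>2 = t" "Re \<mu> * Im \<mu> = 0"
    using arg_cong[OF assms(1), of Re] arg_cong[OF assms(1), of Im]
    by (auto simp: power2_eq_square)
  then show ?thesis
    using assms(2) by (cases "Im \<mu> = 0") auto
qed

text \<open>This is the Hermitian form of the real symmetric matrix with diagonal \<open>p\<close>,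
  \<open>r\<close> and off-diagonal entry \<open>s\<close>. Replacing \<open>p\<close> and
  \<open>r\<close> by \<open>\<bar>s\<bar>\<close> and bounding the cross term by Cauchy-Schwarz
  leaves the perfect square \<open>\<bar>s\<bar> * (cmod x - cmod y)\<^sup>2\<close>.\<close>

lemma diag_dominant_form_nonneg:
  fixes x y :: complex and p r s :: real
  assumes "\<bar>s\<bar> \<le> p" and "\<bar>s\<bar> \<le> r"
  shows "0 \<le> p * (cmod x)\<^sup>2 + 2 * s * Re (x * cnj y) + r * (cmod y)\<^sup>2"
proof -
  have "\<bar>Re (x * cnj y)\<bar> \<le> cmod x * cmod y"
    using abs_Re_le_cmod[of "x * cnj y"] by (simp add: norm_mult)
  then have "\<bar>s\<bar> * \<bar>Re (x * cnj y)\<bar> \<le> \<bar>s\<bar> * (cmod x * cmod y)"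
    by (rule mult_left_mono) simp
  then have cross: "- (\<bar>s\<bar> * (cmod x * cmod y)) \<le> s * Re (x * cnj y)"
    by (metis abs_le_D2 abs_mult minus_le_iff)
  have "0 \<le> \<bar>s\<bar> * (cmod x - cmod y)\<^sup>2"
    by simp
  also have "\<dots> = \<bar>s\<bar> * (cmod x)\<^sup>2 - 2 * (\<bar>s\<bar> * (cmod x * cmod y)) + \<bar>s\<bar> * (cmod y)\<^sup>2"
    by (simp add: power2_diff algebra_simps)
  also have "\<dots> \<le> p * (cmod x)\<^sup>2 + 2 * (s * Re (x * cnj y)) + r * (cmod y)\<^sup>2"
    using cross mult_right_mono[OF assms(1), of "(cmod x)\<^sup>2"]
      mult_right_mono[OF assms(2), of "(cmod y)\<^sup>2"] by simp
  finally show ?thesis by (simp add: mult.assoc)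
qed

lemma oscillator_eigenvalue_imaginary:
  fixes x y u v \<mu> :: complex and c1 c2 p r s :: real
  assumes c: "0 < c1" "0 < c2" and dom: "\<bar>s\<bar> \<le> p" "\<bar>s\<bar> \<le> r"
    and u: "2 / c1 * u = \<mu> * x" and v: "2 / c2 * v = \<mu> * y"
    and x: "- p * x - s * y = \<mu> * u" and y: "- s * x - r * y = \<mu> * v"
    and nz: "x \<noteq> 0 \<or> y \<noteq> 0"
  shows "Re \<mu> = 0"
proof -
  define W where "W = (c1 * (cmod x)\<^sup>2 + c2 * (cmod y)\<^sup>2) / 2"
  define Q where "Q = p * (cmod x)\<^sup>2 + 2 * s * Re (x * cnj y) + r * (cmod y)\<^sup>2"
  have W: "0 < W"
    using c nz unfolding W_def by (auto intro: add_pos_nonneg add_nonneg_pos)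
  have Q: "0 \<le> Q"
    unfolding Q_def by (rule diag_dominant_form_nonneg[OF dom])
  have u': "u = c1 * \<mu> * x / 2" and v': "v = c2 * \<mu> * y / 2"
    using u v c by (simp_all add: field_simps)
  \<comment> \<open>Symmetry enters here: with the same \<open>s\<close> in both rows, the two mixed
    terms are complex conjugates and add up to a real number.\<close>
  have cross: "complex_of_real (2 * Re (x * cnj y)) = x * cnj y + cnj x * y"
    by (simp add: complex_eq_iff)
  \<comment> \<open>Eliminate the momenta, then pair the two momentum rows with \<open>cnj x\<close>
    and \<open>cnj y\<close>.\<close>
  have "\<mu>\<^sup>2 * W = \<mu> * u * cnj x + \<mu> * v * cnj y"
    unfolding u' v' W_def of_real_divide of_real_add of_real_mult complex_norm_square
    by (simp add: power2_eq_square field_simps)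
  also have "\<dots> = (- p * x - s * y) * cnj x + (- s * x - r * y) * cnj y"
    by (simp only: x y)
  also have "\<dots> = - (p * (x * cnj x) + s * (x * cnj y + cnj x * y) + r * (y * cnj y))"
    by (simp add: algebra_simps)
  also have "\<dots> = complex_of_real (- Q)"
    unfolding cross[symmetric] complex_norm_square[symmetric] Q_def by simp
  finally have "\<mu>\<^sup>2 = of_real (- Q / W)"
    using W by (simp add: field_simps)
  moreover have "- Q / W \<le> 0"
    using W Q by simp
  ultimately show ?thesis
    by (rule Re_eq_0_if_power2_nonpos)
qed

text \<open>Using \<open>K4\<close> and \<open>K5\<close> also in the places of \<open>L4\<close>
  and \<open>L5\<close> makes the stiffness matrix symmetric, with off-diagonal entry
  \<open>K4 - K5\<close>.\<close>

lemma spin_spin_linear_eigenvalue_imaginary: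
  assumes c: "0 < C1" "0 < C2"
    and domK: "\<bar>K4 - K5\<bar> \<le> K1 + K2 + 2 * K3 + K4 + K5"
    and domL: "\<bar>K4 - K5\<bar> \<le> L1 + L2 + 2 * L3 + K4 + K5"
    and ev: "eigenvalue (map_mat complex_of_real
      (spin_spin_linear C1 C2 K1 K2 K3 K4 K5 L1 L2 L3 K4 K5)) \<mu>"
  shows "Re \<mu> = 0"
proof -
  let ?A = "map_mat complex_of_real (spin_spin_linear C1 C2 K1 K2 K3 K4 K5 L1 L2 L3 K4 K5)"
  let ?p = "K1 + K2 + 2 * K3 + K4 + K5" and ?r = "L1 + L2 + 2 * L3 + K4 + K5" and ?s = "K4 - K5"
  have dims: "dim_row ?A = 4" "dim_col ?A = 4"
    by (simp_all add: spin_spin_linear_def mat_of_rows_list_def)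
  obtain z where z: "z \<in> carrier_vec 4" "z \<noteq> 0\<^sub>v 4" "?A *\<^sub>v z = \<mu> \<cdot>\<^sub>v z"
    using ev dims unfolding eigenvalue_def eigenvector_def by auto
  have row: "(?A *\<^sub>v z) $ i = \<mu> * z $ i" if "i < 4" for i
    using z that by simp
  have upt4: "{0..<4::nat} = {0, 1, 2, 3}"
    by auto
  have eqs: "2 / C1 * z $ 2 = \<mu> * z $ 0" "2 / C2 * z $ 3 = \<mu> * z $ 1"
    "- ?p * z $ 0 - ?s * z $ 1 = \<mu> * z $ 2" "- ?s * z $ 0 - ?r * z $ 1 = \<mu> * z $ 3"
    using row[of 0] row[of 1] row[of 2] row[of 3] z(1) dims
    by (simp_all add: spin_spin_linear_def mat_of_rows_list_def scalar_prod_def upt4 algebra_simps)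
  \<comment> \<open>If the positions vanish, the first two rows make the momenta vanish too, since
    \<open>2 / C1\<close> and \<open>2 / C2\<close> are nonzero.\<close>
  have "z $ 0 \<noteq> 0 \<or> z $ 1 \<noteq> 0"
  proof (rule ccontr)
    assume "\<not> ?thesis"
    with eqs(1,2) c have "z $ 0 = 0" "z $ 1 = 0" "z $ 2 = 0" "z $ 3 = 0"
      by auto
    then have "z $ i = 0" if "i < 4" for i
      using that by (auto simp: numeral_eq_Suc less_Suc_eq)
    then have "z = 0\<^sub>v 4"
      using z(1) by (intro eq_vecI) auto
    with z(2) show False by contradiction
  qed
  then show ?thesis
    using eqs by (intro oscillator_eigenvalue_imaginary[OF c domK domL,
          where x = "z $ 0" and y = "z $ 1" and u = "z $ 2" and v = "z $ 3"]) simp_all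
qed

theorem proposition10:
  fixes M1 M2 A1 B1 C1 A2 B2 C2 a e G d1 d2 q1 q2 :: real
    and K1 K2 K3 K4 K5 L1 L2 L3 L4 L5 :: real
  assumes "homogeneous_ellipsoid M1 A1 B1 C1" and "homogeneous_ellipsoid M2 A2 B2 C2"
    and "M1 + M2 = 1" and "C1 + C2 = 1"
    and "0 < a" and "G = a ^ 3"
    and "0 \<le> e" and "e < 1 / sqrt 11"
    and "d1 = B1 - A1" and "d2 = B2 - A2"
    and "q1 = 2 * C1 - B1 - A1" and "q2 = 2 * C2 - B2 - A2"
    and "K1 = 3 * d1 * G * M2 / (2 * a ^ 3) * (1 - 5 / 2 * e\<^sup>2)"
    and "K2 = (75 * d1 * G * M2 * q1 / (56 * a ^ 5 * M1) + 15 * d1 * G * q2 / (8 * a ^ 5)) * (1 + e\<^sup>2)"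
    and "K3 = 75 * d1\<^sup>2 * G * M2 / (16 * a ^ 5 * M1) * (1 - 11 * e\<^sup>2)"
    and "K4 = 1365 * d1 * d2 * e * G / (32 * a ^ 5)"
    and "K5 = 45 * d1 * d2 * e * G / (32 * a ^ 5)"
    and "L1 = 21 * d2 * e * G * M1 / (4 * a ^ 3)"
    and "L2 = 135 * d2 * e * G * q1 / (16 * a ^ 5) + 675 * d2 * e * G * M1 * q2 / (112 * a ^ 5 * M2)"
    and "L3 = 3825 * d2\<^sup>2 * e\<^sup>2 * G * M1 / (32 * a ^ 5 * M2)"
    and "L4 = K4" and "L5 = K5"
  shows "\<forall>\<mu>. eigenvalue (map_mat complex_of_real
               (spin_spin_linear C1 C2 K1 K2 K3 K4 K5 L1 L2 L3 L4 L5)) \<mu> \<longrightarrow> Re \<mu> = 0"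
proof (intro allI impI)
  fix \<mu>
  assume ev: "eigenvalue (map_mat complex_of_real
    (spin_spin_linear C1 C2 K1 K2 K3 K4 K5 L1 L2 L3 L4 L5)) \<mu>"
  note D1 = homogeneous_ellipsoidD[OF assms(1)] and D2 = homogeneous_ellipsoidD[OF assms(2)]
  \<comment> \<open>The sign of \<open>q1\<close> follows from
    \<open>q1 = (C1 - B1) + (C1 - A1)\<close> and the ordering of the moments; likewise for
    \<open>q2\<close>.\<close>
  have M: "0 < M1" "0 < M2" and C: "0 < C1" "0 < C2"
    and d: "0 \<le> d1" "0 \<le> d2" and q: "0 \<le> q1" "0 \<le> q2"
    using D1 D2 assms(9-12) by linarith+
  have G: "0 < G" using assms(5,6) by simp
  \<comment> \<open>The bound makes \<open>1 - 11 * e\<^sup>2\<close> in \<open>K3\<close> positive,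
    and a fortiori \<open>1 - 5 / 2 * e\<^sup>2\<close> in \<open>K1\<close>.\<close>
  have "e\<^sup>2 < (1 / sqrt 11)\<^sup>2"
    using assms(7,8) by (intro power_strict_mono) auto
  then have e2: "e\<^sup>2 < 1 / 11"
    by (simp add: power_divide)
  note nonneg = mult_nonneg_nonneg divide_nonneg_nonneg add_nonneg_nonneg
  have "0 \<le> K1" "0 \<le> K2" "0 \<le> K3" "0 \<le> L1" "0 \<le> L2" "0 \<le> L3"
    unfolding assms(13-15,18-20) using M G d q e2 assms(5,7) by (auto intro!: nonneg)
  moreover have "0 \<le> K4" "0 \<le> K5"
    unfolding assms(16,17) using G d assms(5,7) by (auto intro!: nonneg)
  \<comment> \<open>For nonnegative \<open>K4\<close> and \<open>K5\<close> the distance is at most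
    the sum, and the remaining diagonal terms only help.\<close>
  ultimately have dom: "\<bar>K4 - K5\<bar> \<le> K1 + K2 + 2 * K3 + K4 + K5"
    "\<bar>K4 - K5\<bar> \<le> L1 + L2 + 2 * L3 + K4 + K5"
    by linarith+
  show "Re \<mu> = 0"
    using spin_spin_linear_eigenvalue_imaginary[OF C dom] ev unfolding assms(21,22) .
qed

end
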